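(* Let $G=(V,E,w)$ be an undirected graph with $n$ vertices, $k\in[n-1]$, and let $\{S_i\}_{i=1}^k$ be a $k$-way partition of $V$ achieving $\rho(k)$ whose clusters are almost balanced, i.e. $\frac{1}{2}\cdot\mathrm{vol}(V)/k\le\mathrm{vol}(S_i)\le 2\cdot\mathrm{vol}(V)/k$ for all $i\in[k]$. Suppose $\Upsilon(k)\ge 2176(1+\mathsf{APT})$. Let $\{A_i\}_{i=1}^k$ be the output of spectral clustering (with $k$ eigenvectors) using a $k$-means algorithm of approximation ratio $\mathsf{APT}$. Then there is a permutation $\pi$ of $[k]$ (the optimal correspondence between output clusters and the $S_i$) such that $$\sum_{i=1}^k\mathrm{vol}(A_i\,\triangle\,S_{\pi(i)})\le 2176\,(1+\mathsf{APT})\,\frac{\mathrm{vol}(V)}{\Upsilon(k)}.$$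
   Context: $G=(V,E,w)$ has nonnegative edge weights, $\deg(u)=\sum_v w_{uv}>0$. $w(S,T)$ is the total weight of edges between $S$ and $T$; $\mathrm{vol}(S)=\sum_{u\in S}\deg(u)$; $\Phi(S)=w(S,V\setminus S)/\mathrm{vol}(S)$; $\rho(k)=\min\max_i\Phi(A_i)$ over all partitions of $V$ into $k$ disjoint sets. $\mathcal{N}_G=I-D^{-1/2}AD^{-1/2}$ (with $D$ the degree matrix and $A$ the weighted adjacency matrix) has eigenvalues $\lambda_1\le\cdots\le\lambda_n$ with orthonormal eigenvectors $f_1,\ldots,f_n$; $\Upsilon(k)=\lambda_{k+1}/\rho(k)$. $X\triangle Y=(X\setminus Y)\cup(Y\setminus X)$. Spectral clustering: embed each $u\in V$ as $F(u)=\deg(u)^{-1/2}(f_1(u),\ldots,f_k(u))^\intercal\in\mathbb{R}^k$; for a partition $B_1,\ldots,B_k$ of $V$ its $k$-means cost is $\mathrm{COST}(B_1,\ldots,B_k)=\sum_i\sum_{u\in B_i}\deg(u)\|F(u)-c_i\|^2$ where $c_i$ is the degree-weighted mean of $\{F(u):u\in B_i\}$; a $k$-means algorithm with approximation ratio $\mathsf{APT}$ returns a partition whose cost is at most $\mathsf{APT}$ times the minimum cost; its output partition $A_1,\ldots,A_k$ is the output of spectral clustering. *)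

theory Defs
  imports "HOL-Analysis.Analysis" "HOL-Combinatorics.Permutations"
begin

text \<open>
  The vertex set is the universe of a finite type, and the edges are the pairs of positive weight.
  Loops are allowed; a loop contributes its weight once to the degree.
\<close>

definition deg :: "('v::finite \<Rightarrow> 'v \<Rightarrow> real) \<Rightarrow> 'v \<Rightarrow> real" where
  "deg w u = (\<Sum>v\<in>UNIV. w u v)"

definition weighted_graph :: "('v::finite \<Rightarrow> 'v \<Rightarrow> real) \<Rightarrow> bool" where
  "weighted_graph w \<longleftrightarrow>
     (\<forall>u v. w u v = w v u) \<and> (\<forall>u v. 0 \<le> w u v) \<and> (\<forall>u. 0 < deg w u)"

definition cut_weight :: "('v::finite \<Rightarrow> 'v \<Rightarrow> real) \<Rightarrow> 'v set \<Rightarrow> 'v set \<Rightarrow> real" where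
  "cut_weight w S T = (\<Sum>u\<in>S. \<Sum>v\<in>T. w u v)"

definition vol :: "('v::finite \<Rightarrow> 'v \<Rightarrow> real) \<Rightarrow> 'v set \<Rightarrow> real" where
  "vol w S = (\<Sum>u\<in>S. deg w u)"

definition conductance :: "('v::finite \<Rightarrow> 'v \<Rightarrow> real) \<Rightarrow> 'v set \<Rightarrow> real" where
  "conductance w S = cut_weight w S (- S) / vol w S"

text \<open>
  The parts are required to be nonempty: the conductance and the centre of mass of a part are
  meaningless for the empty set.
\<close>

definition kway_partition :: "nat \<Rightarrow> (nat \<Rightarrow> 'v::finite set) \<Rightarrow> bool" where
  "kway_partition k A \<longleftrightarrow>
     (\<forall>i\<in>{1..k}. A i \<noteq> {}) \<and> disjoint_family_on A {1..k} \<and> (\<Union>i\<in>{1..k}. A i) = UNIV"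

definition max_conductance ::
    "('v::finite \<Rightarrow> 'v \<Rightarrow> real) \<Rightarrow> nat \<Rightarrow> (nat \<Rightarrow> 'v set) \<Rightarrow> real" where
  "max_conductance w k A = Max ((\<lambda>i. conductance w (A i)) ` {1..k})"

definition rho :: "('v::finite \<Rightarrow> 'v \<Rightarrow> real) \<Rightarrow> nat \<Rightarrow> real" where
  "rho w k = Min {max_conductance w k A | A. kway_partition k A}"

definition adjacency_matrix :: "('v::finite \<Rightarrow> 'v \<Rightarrow> real) \<Rightarrow> real^'v^'v" where
  "adjacency_matrix w = (\<chi> u v. w u v)"

definition degree_matrix_inv_sqrt :: "('v::finite \<Rightarrow> 'v \<Rightarrow> real) \<Rightarrow> real^'v^'v" where
  "degree_matrix_inv_sqrt w = (\<chi> u v. if u = v then 1 / sqrt (deg w u) else 0)"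

definition normalized_laplacian :: "('v::finite \<Rightarrow> 'v \<Rightarrow> real) \<Rightarrow> real^'v^'v" where
  "normalized_laplacian w =
     mat 1 - degree_matrix_inv_sqrt w ** adjacency_matrix w ** degree_matrix_inv_sqrt w"

text \<open>
  Since the \<open>CARD('v)\<close> eigenvectors are orthonormal, \<open>lam 1, \<dots>, lam (CARD('v))\<close> lists
  all eigenvalues of \<open>N\<close> with multiplicity.
\<close>

definition ordered_eigenbasis ::
    "real^'v^'v::finite \<Rightarrow> (nat \<Rightarrow> real) \<Rightarrow> (nat \<Rightarrow> real^'v) \<Rightarrow> bool" where
  "ordered_eigenbasis N lam f \<longleftrightarrow>
     (\<forall>i\<in>{1..CARD('v)}. N *v f i = lam i *\<^sub>R f i) \<and>
     (\<forall>i\<in>{1..CARD('v)}. \<forall>j\<in>{1..CARD('v)}. f i \<bullet> f j = (if i = j then 1 else 0)) \<and>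
     mono_on {1..CARD('v)} lam"

text \<open>
  The quotient is taken in the extended reals, where a positive number divided by \<open>0\<close> is
  \<open>\<infinity>\<close>; so it is infinite if \<open>G\<close> has exactly \<open>k\<close> connected components. The
  indeterminate case \<open>0 / 0\<close> evaluates to \<open>0\<close>.
\<close>

definition Upsilon :: "('v::finite \<Rightarrow> 'v \<Rightarrow> real) \<Rightarrow> (nat \<Rightarrow> real) \<Rightarrow> nat \<Rightarrow> ereal" where
  "Upsilon w lam k = ereal (lam (k + 1)) / ereal (rho w k)"

text \<open>
  Points of \<open>\<real>\<^sup>k\<close> are functions on \<open>nat\<close>, of which only the values on
  \<open>{1..k}\<close> matter.
\<close>

definition embedding ::
    "('v::finite \<Rightarrow> 'v \<Rightarrow> real) \<Rightarrow> (nat \<Rightarrow> real^'v) \<Rightarrow> 'v \<Rightarrow> nat \<Rightarrow> real" where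
  "embedding w f u j = (1 / sqrt (deg w u)) * f j $ u"

definition center ::
    "('v::finite \<Rightarrow> 'v \<Rightarrow> real) \<Rightarrow> (nat \<Rightarrow> real^'v) \<Rightarrow> 'v set \<Rightarrow> nat \<Rightarrow> real" where
  "center w f B j = (\<Sum>u\<in>B. deg w u * embedding w f u j) / (\<Sum>u\<in>B. deg w u)"

definition kmeans_cost ::
    "('v::finite \<Rightarrow> 'v \<Rightarrow> real) \<Rightarrow> (nat \<Rightarrow> real^'v) \<Rightarrow> nat \<Rightarrow> (nat \<Rightarrow> 'v set) \<Rightarrow> real" where
  "kmeans_cost w f k B =
     (\<Sum>i=1..k. \<Sum>u\<in>B i.
        deg w u * (L2_set (\<lambda>j. embedding w f u j - center w f (B i) j) {1..k})\<^sup>2)"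

definition kmeans_opt ::
    "('v::finite \<Rightarrow> 'v \<Rightarrow> real) \<Rightarrow> (nat \<Rightarrow> real^'v) \<Rightarrow> nat \<Rightarrow> real" where
  "kmeans_opt w f k = Min {kmeans_cost w f k B | B. kway_partition k B}"

text \<open>
  The only property of the \<open>k\<close>-means algorithm is its approximation guarantee, so an output
  is any partition meeting the guarantee.
\<close>

definition spectral_clustering_output ::
    "('v::finite \<Rightarrow> 'v \<Rightarrow> real) \<Rightarrow> (nat \<Rightarrow> real^'v) \<Rightarrow> nat \<Rightarrow> real \<Rightarrow> (nat \<Rightarrow> 'v set) \<Rightarrow> bool" where
  "spectral_clustering_output w f k APT A \<longleftrightarrow>
     kway_partition k A \<and> kmeans_cost w f k A \<le> APT * kmeans_opt w f k"

end

theory Submission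
  imports Defs
begin

text \<open>
  Let \<open>g i\<close> be the unit vector proportional to \<open>D\<^sup>1\<^sup>/\<^sup>2\<close> times the indicator of
  \<open>S i\<close>, and \<open>\<epsilon> = \<rho>(k) / \<lambda>(k+1)\<close>. Its Rayleigh quotient is the conductance
  of \<open>S i\<close>, so the component of \<open>g i\<close> orthogonal to the first \<open>k\<close> eigenvectors has
  squared norm at most \<open>\<epsilon>\<close>. The \<open>k\<close>-means cost of \<open>S\<close> is the sum of these squared
  norms, hence at most \<open>k \<epsilon>\<close>; and since the \<open>g i\<close> are orthonormal, the centres of the
  \<open>S i\<close> are at squared distance at least \<open>k / (2 vol V)\<close> from each other. Sending each
  \<open>A i\<close> to the cluster \<open>S (\<sigma> i)\<close> with the nearest centre therefore misclassifies a volume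
  \<open>X \<le> 16 (1 + APT) \<epsilon> vol V\<close>. The map \<open>\<sigma>\<close> need not be injective, but it can be
  repaired to a permutation with a misclassified volume of at most \<open>5 X\<close>.
\<close>

section \<open>Orthonormal eigenbases\<close>

text \<open>As many orthonormal vectors as the dimension are independent, hence span the space.
  Injectivity of \<open>f\<close> is proved because the general expansion runs over a set of
  vectors, while here the sum runs over indices.\<close>

lemma ordered_eigenbasis_expand:
  fixes N :: "real^'v^'v::finite"
  assumes "ordered_eigenbasis N lam f"
  shows "(\<Sum>i=1..CARD('v). (x \<bullet> f i) *\<^sub>R f i) = x"
proof -
  let ?I = "{1..CARD('v)}"
  have on: "f i \<bullet> f j = (if i = j then 1 else 0)" if "i \<in> ?I" "j \<in> ?I" for i j
    using assms that unfolding ordered_eigenbasis_def by blast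
  have inj: "inj_on f ?I"
    by (rule inj_onI) (metis on zero_neq_one)
  have orth: "pairwise orthogonal (f ` ?I)"
    by (auto simp: pairwise_def orthogonal_def on)
  have nz: "0 \<notin> f ` ?I"
    using on by fastforce
  have "independent (f ` ?I)"
    using orth nz by (rule pairwise_orthogonal_independent)
  moreover have "card (f ` ?I) = DIM(real^'v)"
    using card_image[OF inj] by simp
  ultimately have span: "span (f ` ?I) = UNIV"
    using card_ge_dim_independent[of "f ` ?I" UNIV] by auto
  have "(\<Sum>b\<in>f ` ?I. (x \<bullet> b) *\<^sub>R b) = x"
    using span by (intro orthonormal_basis_expand[OF orth]) (auto simp: norm_eq_1 on)
  then show ?thesis
    unfolding sum.reindex[OF inj] comp_def .
qed

lemma ordered_eigenbasis_parseval:
  fixes N :: "real^'v^'v::finite"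
  assumes "ordered_eigenbasis N lam f"
  shows "x \<bullet> x = (\<Sum>i=1..CARD('v). (x \<bullet> f i)\<^sup>2)"
proof -
  have "x \<bullet> x = x \<bullet> (\<Sum>i=1..CARD('v). (x \<bullet> f i) *\<^sub>R f i)"
    by (simp only: ordered_eigenbasis_expand[OF assms])
  also have "\<dots> = (\<Sum>i=1..CARD('v). (x \<bullet> f i)\<^sup>2)"
    by (simp add: inner_sum_right power2_eq_square)
  finally show ?thesis .
qed

lemma ordered_eigenbasis_head_eq:
  fixes N :: "real^'v^'v::finite"
  assumes "ordered_eigenbasis N lam f" "k \<le> CARD('v)"
  shows "(\<Sum>l=1..k. (x \<bullet> f l)\<^sup>2) = x \<bullet> x - (\<Sum>l=k+1..CARD('v). (x \<bullet> f l)\<^sup>2)"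
proof -
  have "{1..CARD('v)} = {1..k} \<union> {k+1..CARD('v)}"
    using assms(2) by auto
  then have "x \<bullet> x = (\<Sum>l=1..k. (x \<bullet> f l)\<^sup>2) + (\<Sum>l=k+1..CARD('v). (x \<bullet> f l)\<^sup>2)"
    unfolding ordered_eigenbasis_parseval[OF assms(1), of x] by (simp add: sum.union_disjoint)
  then show ?thesis by simp
qed

lemma ordered_eigenbasis_quadratic_form:
  fixes N :: "real^'v^'v::finite"
  assumes "ordered_eigenbasis N lam f"
  shows "x \<bullet> (N *v x) = (\<Sum>i=1..CARD('v). lam i * (x \<bullet> f i)\<^sup>2)"
proof -
  have ev: "N *v f i = lam i *\<^sub>R f i" if "i \<in> {1..CARD('v)}" for i
    using assms that unfolding ordered_eigenbasis_def by blast
  have "N *v x = N *v (\<Sum>i=1..CARD('v). (x \<bullet> f i) *\<^sub>R f i)"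
    by (simp only: ordered_eigenbasis_expand[OF assms])
  also have "\<dots> = (\<Sum>i=1..CARD('v). (x \<bullet> f i) *\<^sub>R (N *v f i))"
    by (simp add: linear_sum[OF matrix_vector_mul_linear] matrix_vector_mult_scaleR)
  also have "\<dots> = (\<Sum>i=1..CARD('v). (x \<bullet> f i) *\<^sub>R (lam i *\<^sub>R f i))"
    by (intro sum.cong refl) (simp only: ev)
  finally show ?thesis
    by (simp add: inner_sum_right power2_eq_square algebra_simps)
qed

lemma ordered_eigenbasis_tail_bound:
  fixes N :: "real^'v^'v::finite"
  assumes basis: "ordered_eigenbasis N lam f"
    and psd: "\<And>x. 0 \<le> x \<bullet> (N *v x)"
    and k: "k < CARD('v)"
  shows "lam (k + 1) * (\<Sum>i=k+1..CARD('v). (x \<bullet> f i)\<^sup>2) \<le> x \<bullet> (N *v x)"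
proof -
  let ?I = "{1..CARD('v)}"
  have nonneg: "0 \<le> lam i" if "i \<in> ?I" for i
  proof -
    have "f i \<bullet> (N *v f i) = lam i"
      using basis that unfolding ordered_eigenbasis_def by simp
    then show ?thesis using psd[of "f i"] by simp
  qed
  have mono: "mono_on ?I lam"
    using basis unfolding ordered_eigenbasis_def by blast
  have "lam (k + 1) * (\<Sum>i=k+1..CARD('v). (x \<bullet> f i)\<^sup>2)
      = (\<Sum>i=k+1..CARD('v). lam (k + 1) * (x \<bullet> f i)\<^sup>2)"
    by (rule sum_distrib_left)
  also have "\<dots> \<le> (\<Sum>i=k+1..CARD('v). lam i * (x \<bullet> f i)\<^sup>2)"
    by (intro sum_mono mult_right_mono mono_onD[OF mono]) (use k in auto)
  also have "\<dots> \<le> (\<Sum>i\<in>?I. lam i * (x \<bullet> f i)\<^sup>2)"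
    by (intro sum_mono2) (use nonneg in auto)
  also have "\<dots> = x \<bullet> (N *v x)"
    by (rule ordered_eigenbasis_quadratic_form[OF basis, symmetric])
  finally show ?thesis .
qed

section \<open>The quadratic form of the normalized Laplacian\<close>

lemma deg_pos: "weighted_graph w \<Longrightarrow> 0 < deg w u"
  by (simp add: weighted_graph_def)

lemma normalized_laplacian_component:
  "(normalized_laplacian w *v x) $ u
     = x $ u - (\<Sum>v\<in>UNIV. w u v * x $ v / (sqrt (deg w u) * sqrt (deg w v)))"
proof -
  have "(degree_matrix_inv_sqrt w ** adjacency_matrix w ** degree_matrix_inv_sqrt w) $ u $ v
      = w u v / (sqrt (deg w u) * sqrt (deg w v))" for v
    by (simp add: matrix_matrix_mult_def degree_matrix_inv_sqrt_def adjacency_matrix_def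
        if_distrib[of "\<lambda>a. a * _"] if_distrib[of "\<lambda>a. _ * a"] cong: if_cong)
  then show ?thesis
    by (simp add: normalized_laplacian_def matrix_vector_mult_diff_rdistrib)
       (simp add: matrix_vector_mult_def)
qed

text \<open>Writing a vector as \<open>D\<^sup>1\<^sup>/\<^sup>2 y\<close> cancels the square roots
  in the matrix. Since all degrees are positive, every vector has this form.\<close>

lemma normalized_laplacian_quadratic_form:
  assumes "weighted_graph w"
  shows "(\<chi> u. sqrt (deg w u) * y u) \<bullet> (normalized_laplacian w *v (\<chi> u. sqrt (deg w u) * y u))
       = (\<Sum>u\<in>UNIV. deg w u * (y u)\<^sup>2) - (\<Sum>u\<in>UNIV. \<Sum>v\<in>UNIV. w u v * y u * y v)"
proof -
  have pos: "0 < deg w u" for u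
    using assms by (rule deg_pos)
  have "(normalized_laplacian w *v (\<chi> u. sqrt (deg w u) * y u)) $ u
      = sqrt (deg w u) * y u - (\<Sum>v\<in>UNIV. w u v * y v) / sqrt (deg w u)" for u
    using pos[THEN less_imp_neq]
    by (simp add: normalized_laplacian_component sum_divide_distrib)
  then have "(\<chi> u. sqrt (deg w u) * y u) \<bullet>
        (normalized_laplacian w *v (\<chi> u. sqrt (deg w u) * y u))
      = (\<Sum>u\<in>UNIV. (sqrt (deg w u) * y u) *
          (sqrt (deg w u) * y u - (\<Sum>v\<in>UNIV. w u v * y v) / sqrt (deg w u)))"
    by (simp add: inner_vec_def)
  also have "\<dots> = (\<Sum>u\<in>UNIV. deg w u * (y u)\<^sup>2 - (\<Sum>v\<in>UNIV. w u v * y u * y v))"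
  proof (intro sum.cong refl)
    fix u
    have "sqrt (deg w u) * sqrt (deg w u) = deg w u" "sqrt (deg w u) \<noteq> 0"
      using pos[of u] by auto
    then have "(sqrt (deg w u) * y u) *
          (sqrt (deg w u) * y u - (\<Sum>v\<in>UNIV. w u v * y v) / sqrt (deg w u))
        = deg w u * (y u)\<^sup>2 - y u * (\<Sum>v\<in>UNIV. w u v * y v)"
      by (simp add: field_simps power2_eq_square)
    then show "(sqrt (deg w u) * y u) *
          (sqrt (deg w u) * y u - (\<Sum>v\<in>UNIV. w u v * y v) / sqrt (deg w u))
        = deg w u * (y u)\<^sup>2 - (\<Sum>v\<in>UNIV. w u v * y u * y v)"
      by (simp add: sum_distrib_left mult_ac)
  qed
  finally show ?thesis
    by (simp add: sum_subtractf)
qed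

text \<open>Twice the form is the Dirichlet sum of \<open>w u v * (y u - y v)\<^sup>2\<close> over
  ordered pairs. By symmetry of \<open>w\<close>, both square terms of the expansion sum to the
  degree term.\<close>

lemma normalized_laplacian_psd:
  assumes G: "weighted_graph w"
  shows "0 \<le> x \<bullet> (normalized_laplacian w *v x)"
proof -
  define y where "y u = x $ u / sqrt (deg w u)" for u
  have x: "x = (\<chi> u. sqrt (deg w u) * y u)"
    using deg_pos[OF G] by (simp add: y_def vec_eq_iff less_imp_neq[symmetric])
  have sym: "w u v = w v u" and nonneg: "0 \<le> w u v" for u v
    using G by (auto simp: weighted_graph_def)
  have l: "(\<Sum>u\<in>UNIV. \<Sum>v\<in>UNIV. w u v * (y u)\<^sup>2) = (\<Sum>u\<in>UNIV. deg w u * (y u)\<^sup>2)"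
    by (simp add: deg_def sum_distrib_right)
  have r: "(\<Sum>u\<in>UNIV. \<Sum>v\<in>UNIV. w u v * (y v)\<^sup>2) = (\<Sum>u\<in>UNIV. deg w u * (y u)\<^sup>2)"
    by (subst sum.swap) (simp add: deg_def sum_distrib_right sym flip: l)
  have "0 \<le> (\<Sum>u\<in>UNIV. \<Sum>v\<in>UNIV. w u v * (y u - y v)\<^sup>2)"
    by (intro sum_nonneg mult_nonneg_nonneg nonneg zero_le_power2)
  also have "\<dots> = (\<Sum>u\<in>UNIV. \<Sum>v\<in>UNIV. w u v * (y u)\<^sup>2 + w u v * (y v)\<^sup>2 - 2 * (w u v * y u * y v))"
    by (intro sum.cong refl) (simp add: power2_eq_square algebra_simps)
  also have "\<dots> = 2 * (x \<bullet> (normalized_laplacian w *v x))"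
    unfolding x normalized_laplacian_quadratic_form[OF G]
    by (simp add: sum.distrib sum_subtractf l r flip: sum_distrib_left)
  finally show ?thesis by simp
qed

section \<open>Normalized indicator vectors\<close>

definition indicator_vec :: "('v::finite \<Rightarrow> 'v \<Rightarrow> real) \<Rightarrow> 'v set \<Rightarrow> real^'v" where
  "indicator_vec w B = (\<chi> u. sqrt (deg w u) * (indicator B u / sqrt (vol w B)))"

lemma vol_pos: "weighted_graph w \<Longrightarrow> B \<noteq> {} \<Longrightarrow> 0 < vol w B"
  unfolding vol_def by (intro sum_pos) (auto simp: deg_pos)

lemma vol_nonneg: "weighted_graph w \<Longrightarrow> 0 \<le> vol w B"
  unfolding vol_def by (intro sum_nonneg) (simp add: deg_pos less_imp_le)

lemma vol_mono: "weighted_graph w \<Longrightarrow> B \<subseteq> C \<Longrightarrow> vol w B \<le> vol w C"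
  unfolding vol_def by (intro sum_mono2) (auto simp: deg_pos less_imp_le)

text \<open>The form evaluates to (vol B - w(B,B)) / vol B, and splitting each degree into edges
  inside and outside B leaves the cut weight. Loops enter vol B and w(B,B) once each, so they
  cancel.\<close>

lemma indicator_vec_quadratic_form:
  assumes G: "weighted_graph w" and "B \<noteq> {}"
  shows "indicator_vec w B \<bullet> (normalized_laplacian w *v indicator_vec w B) = conductance w B"
proof -
  have v: "0 < vol w B"
    using assms by (rule vol_pos)
  let ?y = "\<lambda>u. indicator B u / sqrt (vol w B)"
  have "(\<Sum>u\<in>UNIV. deg w u * (?y u)\<^sup>2) = (\<Sum>u\<in>UNIV. indicator B u * deg w u) / vol w B"
    unfolding sum_divide_distrib using v
    by (intro sum.cong refl) (auto simp: power_divide indicator_def)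
  also have "\<dots> = vol w B / vol w B"
    by (simp add: vol_def sum_indicator_mult)
  finally have 1: "(\<Sum>u\<in>UNIV. deg w u * (?y u)\<^sup>2) = vol w B / vol w B" .
  have "(\<Sum>u\<in>UNIV. \<Sum>v\<in>UNIV. w u v * ?y u * ?y v)
      = (\<Sum>u\<in>UNIV. indicator B u * (\<Sum>v\<in>UNIV. indicator B v * w u v)) / vol w B"
    unfolding sum_divide_distrib sum_distrib_left using v
    by (intro sum.cong refl) (auto simp: indicator_def)
  also have "\<dots> = cut_weight w B B / vol w B"
    by (simp add: cut_weight_def indicator_def if_distrib[of "\<lambda>a. a * _"] sum.If_cases cong: if_cong)
  finally have 2: "(\<Sum>u\<in>UNIV. \<Sum>v\<in>UNIV. w u v * ?y u * ?y v) = cut_weight w B B / vol w B" .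
  have "deg w u = (\<Sum>v\<in>B. w u v) + (\<Sum>v\<in>-B. w u v)" for u
    unfolding deg_def by (subst sum.union_disjoint[symmetric]) auto
  then have "vol w B = cut_weight w B B + cut_weight w B (-B)"
    by (simp add: vol_def cut_weight_def sum.distrib)
  then show ?thesis
    unfolding indicator_vec_def normalized_laplacian_quadratic_form[OF G] 1 2 conductance_def
    by (metis add_diff_cancel_left' diff_divide_distrib)
qed

lemma indicator_vec_inner:
  "indicator_vec w B \<bullet> x = (\<Sum>u\<in>B. sqrt (deg w u) * x $ u) / sqrt (vol w B)"
proof -
  have "indicator_vec w B \<bullet> x
      = (\<Sum>u\<in>UNIV. indicator B u * (sqrt (deg w u) * x $ u / sqrt (vol w B)))"
    by (simp add: indicator_vec_def inner_vec_def mult_ac)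
  then show ?thesis
    unfolding sum_divide_distrib by (simp only: sum_indicator_mult finite UNIV_I simp_thms Collect_mem_eq)
qed

lemma indicator_vec_norm:
  assumes G: "weighted_graph w" and "B \<noteq> {}"
  shows "indicator_vec w B \<bullet> indicator_vec w B = 1"
proof -
  have v: "0 < vol w B"
    using assms by (rule vol_pos)
  have "indicator_vec w B \<bullet> indicator_vec w B = (\<Sum>u\<in>B. deg w u / sqrt (vol w B)) / sqrt (vol w B)"
    unfolding indicator_vec_inner using deg_pos[OF G]
    by (intro arg_cong2[of _ _ _ _ "(/)"] sum.cong refl)
       (simp add: indicator_vec_def less_imp_le flip: mult.assoc)
  also have "\<dots> = 1"
    using v by (simp add: field_simps flip: sum_divide_distrib vol_def)
  finally show ?thesis .
qed

lemma indicator_vec_orthogonal: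
  assumes "B \<inter> C = {}"
  shows "indicator_vec w B \<bullet> indicator_vec w C = 0"
proof -
  have "sqrt (deg w u) * indicator_vec w C $ u = 0" if "u \<in> B" for u
    using that assms by (auto simp: indicator_vec_def indicator_def)
  then show ?thesis
    unfolding indicator_vec_inner by (simp add: sum.neutral)
qed

text \<open>The bridge from the embedding to the spectrum: the weight \<open>deg w u\<close> turns
  the factor deg^(-1/2) of the embedding into the factor deg^(1/2) of
  \<open>indicator_vec\<close>.\<close>

lemma center_eq_inner:
  assumes G: "weighted_graph w" and "B \<noteq> {}"
  shows "center w f B j = (indicator_vec w B \<bullet> f j) / sqrt (vol w B)"
proof -
  have v: "0 < vol w B"
    using assms by (rule vol_pos)
  have "deg w u * embedding w f u j = sqrt (deg w u) * f j $ u" for u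
    using real_div_sqrt[of "deg w u"] deg_pos[OF G, of u]
    by (simp add: embedding_def flip: times_divide_eq_left)
  then show ?thesis
    using v by (simp add: center_def indicator_vec_inner flip: vol_def)
qed


section \<open>The cost of a partition\<close>

lemma sum_kway_partition:
  assumes "kway_partition k A"
  shows "sum g UNIV = (\<Sum>i=1..k. sum g (A i))"
proof -
  have "sum g UNIV = sum g (\<Union>i\<in>{1..k}. A i)"
    using assms by (simp add: kway_partition_def)
  also have "\<dots> = (\<Sum>i=1..k. sum g (A i))"
    using assms unfolding kway_partition_def disjoint_family_on_def
    by (intro sum.UNION_disjoint) auto
  finally show ?thesis .
qed

lemma kmeans_cost_eq:
  "kmeans_cost w f k B = (\<Sum>i=1..k. \<Sum>u\<in>B i. deg w u *
      (\<Sum>j=1..k. (embedding w f u j - center w f (B i) j)\<^sup>2))"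
  by (simp add: kmeans_cost_def L2_set_def sum_nonneg)

text \<open>The variance identity for one coordinate: second moment minus squared mean times total
  weight. The second moment of the embedding is that of \<open>f j\<close> without weights.\<close>

lemma part_cost_eq:
  assumes G: "weighted_graph w" and "B \<noteq> {}"
  shows "(\<Sum>u\<in>B. deg w u * (embedding w f u j - center w f B j)\<^sup>2)
       = (\<Sum>u\<in>B. (f j $ u)\<^sup>2) - (indicator_vec w B \<bullet> f j)\<^sup>2"
proof -
  define c where "c = center w f B j"
  have v: "0 < vol w B"
    using assms by (rule vol_pos)
  have e: "(\<Sum>u\<in>B. deg w u * embedding w f u j) = c * vol w B"
    using v by (simp add: c_def center_def flip: vol_def)
  have sq: "c\<^sup>2 * vol w B = (indicator_vec w B \<bullet> f j)\<^sup>2"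
    using v by (simp add: c_def center_eq_inner[OF assms] power_divide)
  have de: "deg w u * (embedding w f u j)\<^sup>2 = (f j $ u)\<^sup>2" for u
    using deg_pos[OF G, of u] by (simp add: embedding_def power_divide)
  have "(\<Sum>u\<in>B. deg w u * (embedding w f u j - c)\<^sup>2)
      = (\<Sum>u\<in>B. deg w u * (embedding w f u j)\<^sup>2 - 2 * c * (deg w u * embedding w f u j)
          + c\<^sup>2 * deg w u)"
    by (intro sum.cong refl) (simp add: power2_eq_square algebra_simps)
  also have "\<dots> = (\<Sum>u\<in>B. (f j $ u)\<^sup>2) - 2 * c * (c * vol w B) + c\<^sup>2 * vol w B"
    by (simp add: de sum.distrib sum_subtractf e vol_def flip: sum_distrib_left)
  also have "\<dots> = (\<Sum>u\<in>B. (f j $ u)\<^sup>2) - c\<^sup>2 * vol w B"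
    by (simp add: power2_eq_square algebra_simps)
  finally show ?thesis
    unfolding sq unfolding c_def .
qed

text \<open>Summing the variance identity over all parts, the \<open>k\<close> unit vectors
  \<open>f j\<close> contribute \<open>k\<close> in total. As there are also \<open>k\<close> parts,
  each receives one unit, the squared norm of its indicator vector; what remains is the part of that
  norm missed by the first \<open>k\<close> eigenvectors.\<close>

lemma kmeans_cost_eq_deficiency:
  fixes N :: "real^'v^'v::finite"
  assumes G: "weighted_graph w" and basis: "ordered_eigenbasis N lam f"
    and k: "k \<le> CARD('v)" and B: "kway_partition k B"
  shows "kmeans_cost w f k B
       = (\<Sum>i=1..k. 1 - (\<Sum>j=1..k. (indicator_vec w (B i) \<bullet> f j)\<^sup>2))"
proof -
  have ne: "B i \<noteq> {}" if "i \<in> {1..k}" for i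
    using B that by (simp add: kway_partition_def)
  have norm: "(\<Sum>u\<in>UNIV. (f j $ u)\<^sup>2) = 1" if "j \<in> {1..k}" for j
  proof -
    have "f j \<bullet> f j = 1"
      using basis that k unfolding ordered_eigenbasis_def by simp
    then show ?thesis
      by (simp add: inner_vec_def power2_eq_square)
  qed
  have "kmeans_cost w f k B
      = (\<Sum>i=1..k. \<Sum>j=1..k. \<Sum>u\<in>B i. deg w u * (embedding w f u j - center w f (B i) j)\<^sup>2)"
    unfolding kmeans_cost_eq sum_distrib_left by (intro sum.cong refl sum.swap)
  also have "\<dots> = (\<Sum>i=1..k. \<Sum>j=1..k. (\<Sum>u\<in>B i. (f j $ u)\<^sup>2) - (indicator_vec w (B i) \<bullet> f j)\<^sup>2)"
    by (intro sum.cong refl part_cost_eq[OF G] ne)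
  also have "\<dots> = (\<Sum>j=1..k. \<Sum>i=1..k. \<Sum>u\<in>B i. (f j $ u)\<^sup>2)
      - (\<Sum>i=1..k. \<Sum>j=1..k. (indicator_vec w (B i) \<bullet> f j)\<^sup>2)"
    unfolding sum_subtractf by (subst sum.swap) simp
  also have "(\<Sum>j=1..k. \<Sum>i=1..k. \<Sum>u\<in>B i. (f j $ u)\<^sup>2) = (\<Sum>j=1..k. 1)"
    by (intro sum.cong refl) (simp only: norm sum_kway_partition[OF B, symmetric])
  finally show ?thesis
    by (simp add: sum_subtractf)
qed

text \<open>\<open>Min\<close> is meaningful only on a finite set. There are infinitely many
  families \<open>B\<close>, but the cost depends only on their values on
  \<open>{1..k}\<close>.\<close>

lemma kmeans_opt_le:
  assumes "kway_partition k B"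
  shows "kmeans_opt w f k \<le> kmeans_cost w f k B"
proof -
  have "kmeans_cost w f k C = kmeans_cost w f k (restrict C {1..k})" for C
    unfolding kmeans_cost_def by (intro sum.cong) auto
  then have "range (kmeans_cost w f k) \<subseteq> kmeans_cost w f k ` ({1..k} \<rightarrow>\<^sub>E UNIV)"
    by (metis (no_types, lifting) image_iff image_subsetI restrict_PiE_iff UNIV_I)
  then have "finite (range (kmeans_cost w f k))"
    by (rule finite_subset) (simp add: finite_PiE)
  then have "finite {kmeans_cost w f k B | B. kway_partition k B}"
    by (rule rev_finite_subset) auto
  then show ?thesis
    unfolding kmeans_opt_def using assms by (intro Min_le) auto
qed

section \<open>Matching the output with the optimal clusters\<close>

text \<open>A misclassified vertex cannot be close both to the centre of its output part and to the
  centre of its own cluster, so \<Delta> times its degree is charged to its two cost terms. Each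
  vertex is charged once because both families partition the vertex set.\<close>

lemma nearest_center_misclassified:
  assumes G: "weighted_graph w" and A: "kway_partition k A" and S: "kway_partition k S"
    and k: "1 \<le> k"
    and sep: "\<And>i j. i \<in> {1..k} \<Longrightarrow> j \<in> {1..k} \<Longrightarrow> i \<noteq> j \<Longrightarrow>
        \<Delta> \<le> (\<Sum>l=1..k. (center w f (S i) l - center w f (S j) l)\<^sup>2)"
  obtains \<sigma> where "\<sigma> \<in> {1..k} \<rightarrow> {1..k}"
    and "\<Delta> * (\<Sum>i=1..k. vol w (A i - S (\<sigma> i))) \<le> 8 * (kmeans_cost w f k A + kmeans_cost w f k S)"
proof -
  let ?K = "{1..k}"
  define dst where "dst x y = (\<Sum>l=1..k. (x l - y l)\<^sup>2)" for x y :: "nat \<Rightarrow> real"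
  define e where "e = embedding w f"
  define a where "a i = center w f (A i)" for i
  define p where "p i = center w f (S i)" for i
  have dst_tri: "dst x z \<le> 2 * (dst y x + dst y z)" for x y z
  proof -
    \<comment> \<open>With a = y - x and b = y - z this is the parallelogram law: 2(a^2 + b^2) - (a
      - b)^2 = (a + b)^2.\<close>
    have "(x l - z l)\<^sup>2 \<le> 2 * ((y l - x l)\<^sup>2 + (y l - z l)\<^sup>2)" for l
      using zero_le_power2[of "x l + z l - 2 * y l"]
      by (simp add: power2_eq_square algebra_simps)
    then show ?thesis
      unfolding dst_def sum.distrib[symmetric] sum_distrib_left by (intro sum_mono)
  qed
  have dst_nonneg: "0 \<le> dst x y" for x y
    unfolding dst_def by (intro sum_nonneg) simp
  have deg: "0 \<le> deg w u" for u
    using deg_pos[OF G] by (simp add: less_imp_le)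
  have "\<exists>j. j \<in> ?K \<and> (\<forall>l\<in>?K. dst (a i) (p j) \<le> dst (a i) (p l))" for i
    using ex_is_arg_min_if_finite[of ?K "\<lambda>j. dst (a i) (p j)"] k
    by (auto simp: is_arg_min_linorder)
  then obtain \<sigma> where \<sigma>K: "\<And>i. \<sigma> i \<in> ?K"
      and \<sigma>: "\<And>i l. l \<in> ?K \<Longrightarrow> dst (a i) (p (\<sigma> i)) \<le> dst (a i) (p l)"
    by metis
  have "\<exists>j\<in>?K. u \<in> S j" for u
    using S unfolding kway_partition_def by blast
  then obtain s where s: "\<And>u. s u \<in> ?K" "\<And>u. u \<in> S (s u)"
    by metis
  have s_eq: "s u = j" if "j \<in> ?K" "u \<in> S j" for u j
    using S s that unfolding kway_partition_def disjoint_family_on_def by blast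
  \<comment> \<open>The 8 is a product of three factors 2: the triangle inequality for squares
    through \<open>a i\<close>, the minimality of \<open>\<sigma> i\<close>, and the triangle
    inequality through \<open>e u\<close>.\<close>
  have far: "\<Delta> \<le> 8 * (dst (e u) (a i) + dst (e u) (p (s u)))" if "u \<notin> S (\<sigma> i)" for u i
  proof -
    have "s u \<noteq> \<sigma> i"
      using that s(2) by metis
    then have "\<Delta> \<le> dst (p (s u)) (p (\<sigma> i))"
      using sep s(1) \<sigma>K unfolding dst_def p_def by blast
    also have "\<dots> \<le> 2 * (dst (a i) (p (s u)) + dst (a i) (p (\<sigma> i)))"
      by (rule dst_tri)
    also have "\<dots> \<le> 4 * dst (a i) (p (s u))"
      using \<sigma>[OF s(1), of i u] by simp
    also have "\<dots> \<le> 4 * (2 * (dst (e u) (a i) + dst (e u) (p (s u))))"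
      using dst_tri[of "a i" "p (s u)" "e u"] by simp
    finally show ?thesis by simp
  qed
  \<comment> \<open>The summand depends on \<open>u\<close> alone, so the sum can be regrouped from
    the parts of \<open>A\<close> to those of \<open>S\<close>.\<close>
  have costS: "(\<Sum>i=1..k. \<Sum>u\<in>A i. deg w u * dst (e u) (p (s u))) = kmeans_cost w f k S"
  proof -
    have "(\<Sum>i=1..k. \<Sum>u\<in>A i. deg w u * dst (e u) (p (s u)))
        = (\<Sum>j=1..k. \<Sum>u\<in>S j. deg w u * dst (e u) (p (s u)))"
      unfolding sum_kway_partition[OF A, symmetric] by (rule sum_kway_partition[OF S])
    also have "\<dots> = (\<Sum>j=1..k. \<Sum>u\<in>S j. deg w u * dst (e u) (p j))"
      by (intro sum.cong refl) (simp add: s_eq)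
    finally show ?thesis
      by (simp add: kmeans_cost_eq dst_def e_def p_def)
  qed
  have "\<Delta> * (\<Sum>i=1..k. vol w (A i - S (\<sigma> i))) = (\<Sum>i=1..k. \<Sum>u\<in>A i - S (\<sigma> i). deg w u * \<Delta>)"
    by (simp add: vol_def sum_distrib_left mult.commute)
  also have "\<dots> \<le> (\<Sum>i=1..k. \<Sum>u\<in>A i - S (\<sigma> i).
      deg w u * (8 * (dst (e u) (a i) + dst (e u) (p (s u)))))"
    by (intro sum_mono mult_left_mono far deg) auto
  also have "\<dots> \<le> (\<Sum>i=1..k. \<Sum>u\<in>A i. deg w u * (8 * (dst (e u) (a i) + dst (e u) (p (s u)))))"
    by (intro sum_mono sum_mono2 mult_nonneg_nonneg deg add_nonneg_nonneg dst_nonneg) auto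
  also have "\<dots> = 8 * ((\<Sum>i=1..k. \<Sum>u\<in>A i. deg w u * dst (e u) (a i))
      + (\<Sum>i=1..k. \<Sum>u\<in>A i. deg w u * dst (e u) (p (s u))))"
    by (simp add: sum_distrib_left algebra_simps flip: sum.distrib)
  also have "\<dots> = 8 * (kmeans_cost w f k A + kmeans_cost w f k S)"
    unfolding costS by (simp add: kmeans_cost_eq dst_def e_def a_def)
  finally show thesis
    using that[of \<sigma>] \<sigma>K by blast
qed

text \<open>Keep \<sigma> on a set \<open>R\<close> with one preimage of each attained value. As
  many indices lie outside \<open>R\<close> as values are missed, so any bijection between the two
  completes a permutation; \<open>E\<close> is \<open>K - R\<close>.\<close>

lemma ex_permutation_agreeing:
  assumes K: "finite K" and \<sigma>: "\<sigma> \<in> K \<rightarrow> K"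
  obtains \<pi> E where "\<pi> permutes K" "E \<subseteq> K" "card E = card (K - \<sigma> ` K)"
    "\<And>i. i \<in> K - E \<Longrightarrow> \<pi> i = \<sigma> i"
proof -
  obtain R where R: "R \<subseteq> K" "inj_on \<sigma> R" "\<sigma> ` K = \<sigma> ` R"
    using subset_image_inj[of "\<sigma> ` K" \<sigma> K] by auto
  have sub: "\<sigma> ` K \<subseteq> K"
    using \<sigma> by auto
  have "card (K - R) = card (K - \<sigma> ` K)"
    using K R sub by (simp add: card_Diff_subset finite_subset card_image)
  moreover from this obtain h where h: "bij_betw h (K - R) (K - \<sigma> ` K)"
    using K by (metis finite_Diff finite_same_card_bij)
  define \<pi> where "\<pi> i = (if i \<in> R then \<sigma> i else if i \<in> K then h i else i)" for i
  have "bij_betw \<pi> R (\<sigma> ` K)"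
    using R by (simp add: \<pi>_def bij_betw_def inj_on_def image_def)
  moreover have "bij_betw \<pi> (K - R) (K - \<sigma> ` K)"
    using h by (rule bij_betw_cong[THEN iffD1, rotated]) (simp add: \<pi>_def)
  ultimately have "bij_betw \<pi> (R \<union> (K - R)) (\<sigma> ` K \<union> (K - \<sigma> ` K))"
    by (intro bij_betw_combine) auto
  moreover have "R \<union> (K - R) = K" "\<sigma> ` K \<union> (K - \<sigma> ` K) = K"
    using R sub by auto
  ultimately have "\<pi> permutes K"
    using R by (intro bij_imp_permutes) (auto simp: \<pi>_def)
  with \<open>card (K - R) = card (K - \<sigma> ` K)\<close> show thesis
    by (intro that[of \<pi> "K - R"]) (auto simp: \<pi>_def)
qed

lemma vol_Un_le: "weighted_graph w \<Longrightarrow> vol w (B \<union> C) \<le> vol w B + vol w C"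
  using sum.union_inter[of B C "deg w"] vol_nonneg[of w "B \<inter> C"] by (simp add: vol_def)

lemma vol_UN_le:
  assumes "weighted_graph w" "finite I"
  shows "vol w (\<Union>i\<in>I. B i) \<le> (\<Sum>i\<in>I. vol w (B i))"
  using assms(2)
proof induction
  case empty
  then show ?case by (simp add: vol_def)
next
  case (insert i I)
  then show ?case
    using vol_Un_le[OF assms(1), of "B i" "\<Union>i\<in>I. B i"] by simp
qed

text \<open>
  Every cluster \<open>S j\<close> missed by \<open>\<sigma>\<close> is entirely misclassified, so balance bounds the
  number of missed clusters, which is also the number of indices at which \<open>\<sigma>\<close> has to be changed.
\<close>

lemma ex_permutation_sym_diff_le:
  assumes G: "weighted_graph w" and A: "kway_partition k A" and S: "kway_partition k S"
    and \<sigma>: "\<sigma> \<in> {1..k} \<rightarrow> {1..k}"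
    and lower: "\<And>i. i \<in> {1..k} \<Longrightarrow> b \<le> vol w (S i)"
    and upper: "\<And>i. i \<in> {1..k} \<Longrightarrow> vol w (S i) \<le> 4 * b"
  obtains \<pi> where "\<pi> permutes {1..k}"
    and "(\<Sum>i=1..k. vol w (sym_diff (A i) (S (\<pi> i)))) \<le> 10 * (\<Sum>i=1..k. vol w (A i - S (\<sigma> i)))"
proof -
  let ?K = "{1..k}"
  define X where "X = (\<Sum>i=1..k. vol w (A i - S (\<sigma> i)))"
  define U where "U = ?K - \<sigma> ` ?K"
  obtain \<pi> E where \<pi>: "\<pi> permutes ?K" and E: "E \<subseteq> ?K" "card E = card U"
      and agree: "\<And>i. i \<in> ?K - E \<Longrightarrow> \<pi> i = \<sigma> i"
    unfolding U_def using ex_permutation_agreeing[of ?K \<sigma>] \<sigma> by auto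
  have dS: "disjoint_family_on S ?K"
    using S by (simp add: kway_partition_def)
  have "(\<Union>j\<in>U. S j) \<subseteq> (\<Union>i\<in>?K. A i - S (\<sigma> i))"
  proof
    fix u assume "u \<in> (\<Union>j\<in>U. S j)"
    then obtain j where j: "j \<in> ?K" "j \<notin> \<sigma> ` ?K" "u \<in> S j"
      by (auto simp: U_def)
    obtain i where i: "i \<in> ?K" "u \<in> A i"
      using A unfolding kway_partition_def by blast
    have "\<sigma> i \<in> ?K" "\<sigma> i \<noteq> j"
      using i j \<sigma> by auto
    then have "u \<notin> S (\<sigma> i)"
      using dS j unfolding disjoint_family_on_def by blast
    with i show "u \<in> (\<Union>i\<in>?K. A i - S (\<sigma> i))" by blast
  qed
  then have "vol w (\<Union>j\<in>U. S j) \<le> X"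
    unfolding X_def using vol_mono[OF G] vol_UN_le[OF G, of ?K "\<lambda>i. A i - S (\<sigma> i)"]
    by (metis (no_types, lifting) finite_atLeastAtMost order.trans)
  moreover have "vol w (\<Union>j\<in>U. S j) = (\<Sum>j\<in>U. vol w (S j))"
    unfolding vol_def using dS unfolding disjoint_family_on_def U_def
    by (intro sum.UNION_disjoint) auto
  moreover have "(\<Sum>j\<in>U. vol w (S j)) \<ge> (\<Sum>j\<in>U. b)"
    by (intro sum_mono lower) (auto simp: U_def)
  ultimately have card: "real (card E) * b \<le> X"
    using E(2) by simp
  \<comment> \<open>At a changed index, \<open>A i\<close> is covered by its old misclassified part
    and the single cluster \<open>S (\<sigma> i)\<close>, which bounds the extra volume by 4b. Over
    all of \<open>E\<close> this adds at most 4X.\<close>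
  have step: "vol w (A i - S (\<pi> i)) \<le> vol w (A i - S (\<sigma> i)) + (if i \<in> E then 4 * b else 0)"
    if "i \<in> ?K" for i
  proof (cases "i \<in> E")
    case True
    have "vol w (A i - S (\<pi> i)) \<le> vol w ((A i - S (\<sigma> i)) \<union> S (\<sigma> i))"
      by (intro vol_mono[OF G]) auto
    also have "\<dots> \<le> vol w (A i - S (\<sigma> i)) + vol w (S (\<sigma> i))"
      by (rule vol_Un_le[OF G])
    also have "vol w (S (\<sigma> i)) \<le> 4 * b"
      using \<sigma> that by (intro upper) auto
    finally show ?thesis using True by simp
  next
    case False
    then show ?thesis using agree[of i] that by simp
  qed
  have "(\<Sum>i=1..k. vol w (A i - S (\<pi> i)))
      \<le> (\<Sum>i=1..k. vol w (A i - S (\<sigma> i)) + (if i \<in> E then 4 * b else 0))"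
    by (intro sum_mono step)
  also have "\<dots> = X + 4 * (real (card E) * b)"
    using E(1) by (simp add: X_def sum.distrib sum.If_cases Int_absorb1)
  finally have half: "(\<Sum>i=1..k. vol w (A i - S (\<pi> i))) \<le> 5 * X"
    using card by simp
  \<comment> \<open>After summation over \<open>i\<close> the last two terms cancel: \<pi> is a
    permutation, so both families have total volume vol V. Only twice the one-sided differences
    remain, whence 10 = 2 * 5.\<close>
  have sd: "vol w (sym_diff B C) = 2 * vol w (B - C) + vol w C - vol w B" for B C
  proof -
    have "vol w (sym_diff B C) = vol w (B - C) + vol w (C - B)"
      unfolding vol_def by (intro sum.union_disjoint) auto
    moreover have "vol w B = vol w (B - C) + vol w (B \<inter> C)"
      unfolding vol_def by (subst sum.union_disjoint[symmetric]) (auto intro: sum.cong)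
    moreover have "vol w C = vol w (C - B) + vol w (B \<inter> C)"
      unfolding vol_def by (subst sum.union_disjoint[symmetric]) (auto intro: sum.cong)
    ultimately show ?thesis by simp
  qed
  have "(\<Sum>i=1..k. vol w (S (\<pi> i))) = (\<Sum>i=1..k. vol w (S i))"
    using sum.permute[OF \<pi>, of "\<lambda>i. vol w (S i)"] by (simp add: comp_def)
  also have "\<dots> = (\<Sum>i=1..k. vol w (A i))"
    unfolding vol_def using sum_kway_partition[OF S] sum_kway_partition[OF A] by metis
  finally have "(\<Sum>i=1..k. vol w (sym_diff (A i) (S (\<pi> i)))) = 2 * (\<Sum>i=1..k. vol w (A i - S (\<pi> i)))"
    unfolding sd by (simp add: sum.distrib sum_subtractf flip: sum_distrib_left)
  with half show thesis
    by (intro that[OF \<pi>]) (simp add: X_def)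
qed


section \<open>Spectral clustering\<close>

lemma indicator_vec_tail_bound:
  fixes w :: "'v::finite \<Rightarrow> 'v \<Rightarrow> real"
  assumes G: "weighted_graph w" and basis: "ordered_eigenbasis (normalized_laplacian w) lam f"
    and "k < CARD('v)" "0 < lam (k + 1)" "B \<noteq> {}"
  shows "(\<Sum>l=k+1..CARD('v). (indicator_vec w B \<bullet> f l)\<^sup>2) \<le> conductance w B / lam (k + 1)"
  using ordered_eigenbasis_tail_bound[OF basis normalized_laplacian_psd[OF G], of k "indicator_vec w B"]
    assms
  by (simp add: indicator_vec_quadratic_form field_simps)

text \<open>The centres are the coordinates of \<open>x\<close> and \<open>y\<close> in the first
  \<open>k\<close> eigenvectors. Orthogonality gives |x - y|^2 = 1/vol B + 1/vol C, and projecting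
  loses only the tail, at most 2\<epsilon> times this because (a - b)^2 is at most 2a^2 +
  2b^2.\<close>

lemma center_separation:
  fixes N :: "real^'v^'v::finite"
  assumes G: "weighted_graph w" and basis: "ordered_eigenbasis N lam f" and k: "k \<le> CARD('v)"
    and ne: "B \<noteq> {}" "C \<noteq> {}" and disj: "B \<inter> C = {}"
    and B: "(\<Sum>l=k+1..CARD('v). (indicator_vec w B \<bullet> f l)\<^sup>2) \<le> \<epsilon>"
    and C: "(\<Sum>l=k+1..CARD('v). (indicator_vec w C \<bullet> f l)\<^sup>2) \<le> \<epsilon>"
  shows "(1 - 2 * \<epsilon>) * (1 / vol w B + 1 / vol w C)
       \<le> (\<Sum>l=1..k. (center w f B l - center w f C l)\<^sup>2)"
proof -
  let ?T = "{k+1..CARD('v)}"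
  have vB: "0 < vol w B" and vC: "0 < vol w C"
    using G ne by (auto intro: vol_pos)
  define x where "x = (1 / sqrt (vol w B)) *\<^sub>R indicator_vec w B"
  define y where "y = (1 / sqrt (vol w C)) *\<^sub>R indicator_vec w C"
  have xx: "x \<bullet> x = 1 / vol w B" and yy: "y \<bullet> y = 1 / vol w C" and xy: "x \<bullet> y = 0"
    using vB vC by (simp_all add: x_def y_def indicator_vec_norm[OF G] ne
        indicator_vec_orthogonal[OF disj])
  have tx: "(\<Sum>l\<in>?T. (x \<bullet> f l)\<^sup>2) \<le> \<epsilon> / vol w B"
  proof -
    have "(\<Sum>l\<in>?T. (x \<bullet> f l)\<^sup>2) = (\<Sum>l\<in>?T. (indicator_vec w B \<bullet> f l)\<^sup>2) / vol w B"
      using vB by (simp add: x_def power_divide sum_divide_distrib)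
    then show ?thesis using B vB by (simp add: divide_right_mono)
  qed
  have ty: "(\<Sum>l\<in>?T. (y \<bullet> f l)\<^sup>2) \<le> \<epsilon> / vol w C"
  proof -
    have "(\<Sum>l\<in>?T. (y \<bullet> f l)\<^sup>2) = (\<Sum>l\<in>?T. (indicator_vec w C \<bullet> f l)\<^sup>2) / vol w C"
      using vC by (simp add: y_def power_divide sum_divide_distrib)
    then show ?thesis using C vC by (simp add: divide_right_mono)
  qed
  have "(\<Sum>l\<in>?T. ((x - y) \<bullet> f l)\<^sup>2) \<le> (\<Sum>l\<in>?T. 2 * (x \<bullet> f l)\<^sup>2 + 2 * (y \<bullet> f l)\<^sup>2)"
  proof (intro sum_mono)
    fix l
    show "((x - y) \<bullet> f l)\<^sup>2 \<le> 2 * (x \<bullet> f l)\<^sup>2 + 2 * (y \<bullet> f l)\<^sup>2"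
      using zero_le_power2[of "x \<bullet> f l + y \<bullet> f l"]
      by (simp add: inner_diff_left power2_eq_square algebra_simps)
  qed
  also have "\<dots> \<le> 2 * (\<epsilon> / vol w B) + 2 * (\<epsilon> / vol w C)"
    using tx ty by (simp add: sum.distrib flip: sum_distrib_left)
  finally have tail: "(\<Sum>l\<in>?T. ((x - y) \<bullet> f l)\<^sup>2) \<le> 2 * (\<epsilon> / vol w B) + 2 * (\<epsilon> / vol w C)" .
  have "(\<Sum>l=1..k. (center w f B l - center w f C l)\<^sup>2) = (\<Sum>l=1..k. ((x - y) \<bullet> f l)\<^sup>2)"
    by (simp add: center_eq_inner[OF G] ne x_def y_def inner_diff_left)
  also have "\<dots> = (x - y) \<bullet> (x - y) - (\<Sum>l\<in>?T. ((x - y) \<bullet> f l)\<^sup>2)"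
    by (rule ordered_eigenbasis_head_eq[OF basis k])
  also have "(x - y) \<bullet> (x - y) = 1 / vol w B + 1 / vol w C"
    using xx yy xy by (simp add: inner_diff_left inner_diff_right inner_commute)
  finally show ?thesis
    using tail by (simp add: algebra_simps)
qed

text \<open>Transfers the hypothesis and the final bound from extended to ordinary reals, including
  the case of infinite \<open>Upsilon\<close>.\<close>

lemma Upsilon_lower_bound:
  assumes \<rho>: "0 \<le> rho w k" and c: "0 < c" and U: "ereal c \<le> Upsilon w lam k"
  shows "0 < lam (k + 1)" and "c * rho w k \<le> lam (k + 1)"
    and "ereal x / Upsilon w lam k = ereal (x * (rho w k / lam (k + 1)))"
proof -
  have *: "0 < lam (k + 1) \<and> c * rho w k \<le> lam (k + 1)
      \<and> ereal x / Upsilon w lam k = ereal (x * (rho w k / lam (k + 1)))"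
  proof (cases "rho w k = 0")
    case True
    then have Ueq: "Upsilon w lam k = ereal (lam (k + 1)) * \<infinity>"
      by (simp add: Upsilon_def divide_ereal_def)
    \<comment> \<open>Zero or negative \<open>lam (k + 1)\<close> would make the product with
      \<infinity> zero or negative infinity, against the positive lower bound; this excludes
      0/0.\<close>
    have "0 < lam (k + 1)"
      using U c unfolding Ueq by (cases "lam (k + 1)" "0 :: real" rule: linorder_cases) auto
    then show ?thesis
      using True Ueq by simp
  next
    case False
    with \<rho> have pos: "0 < rho w k" by simp
    then have Ueq: "Upsilon w lam k = ereal (lam (k + 1) / rho w k)"
      by (simp add: Upsilon_def)
    have le: "c * rho w k \<le> lam (k + 1)"
      using U pos by (simp add: Ueq field_simps)
    have "0 < lam (k + 1)"
      using le c pos by (meson less_le_trans mult_pos_pos)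
    then show ?thesis
      using le pos by (simp add: Ueq)
  qed
  show "0 < lam (k + 1)" "c * rho w k \<le> lam (k + 1)"
    "ereal x / Upsilon w lam k = ereal (x * (rho w k / lam (k + 1)))"
    using * by auto
qed

theorem theorem2:
  fixes w :: "'v::finite \<Rightarrow> 'v \<Rightarrow> real"
    and lam :: "nat \<Rightarrow> real" and f :: "nat \<Rightarrow> real^'v"
    and k :: nat and APT :: real
    and S A :: "nat \<Rightarrow> 'v set"
  assumes "weighted_graph w"
    and "ordered_eigenbasis (normalized_laplacian w) lam f"
    and "k \<in> {1..CARD('v) - 1}"
    and "kway_partition k S"
    and "max_conductance w k S = rho w k"
    and "\<And>i. i \<in> {1..k} \<Longrightarrow>
           1 / 2 * (vol w UNIV / real k) \<le> vol w (S i) \<and> vol w (S i) \<le> 2 * (vol w UNIV / real k)"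
    and "1 \<le> APT"
    and "Upsilon w lam k \<ge> ereal (2176 * (1 + APT))"
    and "spectral_clustering_output w f k APT A"
  shows "\<exists>\<pi>. \<pi> permutes {1..k} \<and>
           ereal (\<Sum>i=1..k. vol w (sym_diff (A i) (S (\<pi> i))))
             \<le> ereal (2176 * (1 + APT)) * (ereal (vol w UNIV) / Upsilon w lam k)"
proof -
  let ?V = "vol w UNIV"
  note G = assms(1) and basis = assms(2) and S = assms(4) and APT = assms(7)
  have k: "1 \<le> k" "k < CARD('v)"
    using assms(3) by auto
  have A: "kway_partition k A" and costA: "kmeans_cost w f k A \<le> APT * kmeans_opt w f k"
    using assms(9) by (auto simp: spectral_clustering_output_def)
  have ne: "S i \<noteq> {}" if "i \<in> {1..k}" for i
    using S that by (simp add: kway_partition_def)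
  have V: "0 < ?V"
    by (rule vol_pos[OF G]) simp
  have cond_le: "conductance w (S i) \<le> rho w k" if "i \<in> {1..k}" for i
    unfolding assms(5)[symmetric] max_conductance_def using that by (intro Max_ge) auto
  have "0 \<le> conductance w (S 1)"
    using G vol_nonneg[OF G] unfolding conductance_def cut_weight_def weighted_graph_def
    by (intro divide_nonneg_nonneg sum_nonneg) auto
  then have \<rho>: "0 \<le> rho w k"
    using cond_le[of 1] k by simp
  define \<epsilon> where "\<epsilon> = rho w k / lam (k + 1)"
  have APT_pos: "0 < 2176 * (1 + APT)"
    using APT by simp
  note U = Upsilon_lower_bound[OF \<rho> APT_pos assms(8)]
  have \<epsilon>0: "0 \<le> \<epsilon>"
    using \<rho> U(1) by (simp add: \<epsilon>_def)
  \<comment> \<open>The resulting bound 1/4 on \<epsilon> makes the factor 1 - 2\<epsilon> in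
    \<open>center_separation\<close> at least 1/2.\<close>
  have "4 * rho w k \<le> 2176 * (1 + APT) * rho w k"
    using APT \<rho> by (intro mult_right_mono) auto
  then have \<epsilon>4: "\<epsilon> \<le> 1 / 4"
    using U(1,2) by (simp add: \<epsilon>_def field_simps)
  have tail: "(\<Sum>l=k+1..CARD('v). (indicator_vec w (S i) \<bullet> f l)\<^sup>2) \<le> \<epsilon>" if "i \<in> {1..k}" for i
    using indicator_vec_tail_bound[OF G basis k(2) U(1) ne[OF that]]
      divide_right_mono[OF cond_le[OF that], of "lam (k + 1)"] U(1)
    unfolding \<epsilon>_def by linarith
  have costS: "kmeans_cost w f k S \<le> real k * \<epsilon>"
  proof -
    have "kmeans_cost w f k S = (\<Sum>i=1..k. 1 - (\<Sum>j=1..k. (indicator_vec w (S i) \<bullet> f j)\<^sup>2))"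
      using k by (intro kmeans_cost_eq_deficiency[OF G basis _ S]) simp
    also have "\<dots> = (\<Sum>i=1..k. \<Sum>l=k+1..CARD('v). (indicator_vec w (S i) \<bullet> f l)\<^sup>2)"
      using k by (intro sum.cong refl)
        (simp add: ordered_eigenbasis_head_eq[OF basis, unfolded One_nat_def] indicator_vec_norm[OF G] ne)
    also have "\<dots> \<le> (\<Sum>i=1..k. \<epsilon>)"
      by (intro sum_mono tail)
    finally show ?thesis by simp
  qed
  have "kmeans_cost w f k A \<le> APT * (real k * \<epsilon>)"
    using costA mult_left_mono[OF order.trans[OF kmeans_opt_le[OF S] costS], of APT] APT
    by (meson dual_order.trans zero_le_one)
  with costS have costs: "kmeans_cost w f k A + kmeans_cost w f k S \<le> (1 + APT) * (real k * \<epsilon>)"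
    by (simp add: algebra_simps)
  \<comment> \<open>Upper balance gives 1/vol(S i) at least k/(2 vol V); two such terms, halved by 1
    - 2\<epsilon>, give the same value again.\<close>
  have sep: "real k / (2 * ?V) \<le> (\<Sum>l=1..k. (center w f (S i) l - center w f (S j) l)\<^sup>2)"
    if ij: "i \<in> {1..k}" "j \<in> {1..k}" "i \<noteq> j" for i j
  proof -
    have inv: "real k / (2 * ?V) \<le> 1 / vol w (S i)" if "i \<in> {1..k}" for i
      using assms(6)[OF that] vol_pos[OF G ne[OF that]] V k by (simp add: field_simps)
    have disj: "S i \<inter> S j = {}"
      using S ij unfolding kway_partition_def disjoint_family_on_def by blast
    have "real k / (2 * ?V) = 1 / 2 * (real k / (2 * ?V) + real k / (2 * ?V))"
      by simp
    also have "\<dots> \<le> (1 - 2 * \<epsilon>) * (1 / vol w (S i) + 1 / vol w (S j))"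
      using \<epsilon>4 inv[OF ij(1)] inv[OF ij(2)] V by (intro mult_mono add_mono) auto
    also have "\<dots> \<le> (\<Sum>l=1..k. (center w f (S i) l - center w f (S j) l)\<^sup>2)"
      using k by (intro center_separation[OF G basis _ ne ne disj tail tail] ij) simp
    finally show ?thesis .
  qed
  obtain \<sigma> where \<sigma>: "\<sigma> \<in> {1..k} \<rightarrow> {1..k}"
    and mis: "real k / (2 * ?V) * (\<Sum>i=1..k. vol w (A i - S (\<sigma> i)))
        \<le> 8 * (kmeans_cost w f k A + kmeans_cost w f k S)"
    by (rule nearest_center_misclassified[OF G A S k(1) sep])
  define X where "X = (\<Sum>i=1..k. vol w (A i - S (\<sigma> i)))"
  have "real k / (2 * ?V) * X \<le> 8 * ((1 + APT) * (real k * \<epsilon>))"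
    using mis costs by (simp add: X_def)
  also have "\<dots> = real k / (2 * ?V) * (16 * (1 + APT) * ?V * \<epsilon>)"
    using V by simp
  finally have "real k / (2 * ?V) * X \<le> real k / (2 * ?V) * (16 * (1 + APT) * ?V * \<epsilon>)" .
  then have X: "X \<le> 16 * (1 + APT) * ?V * \<epsilon>"
    using k V by (subst (asm) mult_le_cancel_left_pos) auto
  \<comment> \<open>The balance hypotheses are b and 4b for b = vol V / (2k).\<close>
  obtain \<pi> where \<pi>: "\<pi> permutes {1..k}"
    and le: "(\<Sum>i=1..k. vol w (sym_diff (A i) (S (\<pi> i)))) \<le> 10 * X"
    unfolding X_def
    by (rule ex_permutation_sym_diff_le[OF G A S \<sigma>, of "1 / 2 * (?V / real k)"])
       (use assms(6) in auto)
  \<comment> \<open>160 = 10 * 16, from the repair to a permutation and the nearest-centre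
    bound.\<close>
  have "10 * X \<le> 160 * ((1 + APT) * ?V * \<epsilon>)"
    using X by (simp add: algebra_simps)
  also have "\<dots> \<le> 2176 * ((1 + APT) * ?V * \<epsilon>)"
    using APT V \<epsilon>0 by (intro mult_right_mono) auto
  finally have "(\<Sum>i=1..k. vol w (sym_diff (A i) (S (\<pi> i)))) \<le> 2176 * (1 + APT) * (?V * \<epsilon>)"
    using le by (simp add: algebra_simps)
  then show ?thesis
    using \<pi> by (intro exI[of _ \<pi>]) (simp add: U(3) \<epsilon>_def)
qed

end
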